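(* Let $X\subseteq\mathbb{Z}^2\setminus\{O\}$ be an arbitrary non-empty step set. Then $\mathcal{A}_X$ is a group if and only if $O$ belongs to the relative interior of $\operatorname{Conv}(X)$.
   Context: Write $O=(0,0)$. A step set is any (finite or infinite) subset $X$ of $\mathbb{Z}^2\setminus\{O\}$. $\mathcal{A}_X$ is the additive submonoid of $\mathbb{Z}^2$ generated by $X$ (with identity $O$). $\operatorname{Conv}(X)$ is the convex hull of $X$ in $\mathbb{R}^2$. The relative interior of a subset $U\subseteq\mathbb{R}^2$ is its interior relative to the smallest affine subspace of $\mathbb{R}^2$ containing $U$. *)

theory Defs
  imports "HOL-Analysis.Analysis" "HOL-Algebra.Elementary_Groups"
begin

definition int_plane :: "(int \<times> int) monoid" where
  "int_plane = integer_group \<times>\<times> integer_group"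

definition step_set :: "(int \<times> int) set \<Rightarrow> bool" where
  "step_set X \<longleftrightarrow> X \<subseteq> carrier int_plane - {(0, 0)}"

text \<open>The submonoid generated by \<open>X\<close> is the smallest submonoid of \<open>G\<close> containing \<open>X\<close>,
  regarded as a monoid with the operation and identity inherited from \<open>G\<close>.\<close>

definition submonoid_generated :: "('a, 'b) monoid_scheme \<Rightarrow> 'a set \<Rightarrow> ('a, 'b) monoid_scheme" where
  "submonoid_generated G X = G\<lparr>carrier := \<Inter>{H. submonoid H G \<and> X \<subseteq> H}\<rparr>"

definition step_monoid :: "(int \<times> int) set \<Rightarrow> (int \<times> int) monoid" where
  "step_monoid X = submonoid_generated int_plane X"

definition real_point :: "int \<times> int \<Rightarrow> real \<times> real" where
  "real_point p = (real_of_int (fst p), real_of_int (snd p))"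

definition Conv :: "(int \<times> int) set \<Rightarrow> (real \<times> real) set" where
  "Conv X = convex hull (real_point ` X)"

lemma int_plane_simps [simp]:
  "carrier int_plane = UNIV"
  "p \<otimes>\<^bsub>int_plane\<^esub> q = p + q"
  "\<one>\<^bsub>int_plane\<^esub> = (0, 0)"
  by (auto simp: int_plane_def DirProd_def integer_group_def split: prod.splits)

lemma submonoid_step_monoid: "submonoid (carrier (step_monoid X)) int_plane"
  by (auto simp: step_monoid_def submonoid_generated_def submonoid_def)

lemma subset_step_monoid: "X \<subseteq> carrier (step_monoid X)"
  by (auto simp: step_monoid_def submonoid_generated_def)

end

theory Submission
  imports Defs
begin

text \<open>By \<open>convex_rel_interior_iff\<close>, \<open>O\<close> lies in the relative interior of \<open>Conv X\<close> iff every
  \<open>y \<in> Conv X\<close> has a multiple \<open>- e * y\<close> with \<open>e > 0\<close> in \<open>Conv X\<close>. If the monoid is a group, then the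
  cone over \<open>Conv X\<close> contains \<open>- x\<close> for all \<open>x \<in> X\<close>, hence \<open>- y\<close> for all \<open>y \<in> Conv X\<close>. Conversely,
  for \<open>x \<in> X\<close> one obtains a vanishing combination of steps with nonnegative real coefficients and
  a positive coefficient at \<open>x\<close>. By Dirichlet's theorem a large multiple of the coefficients is so
  close to integers that rounding changes the combination by a lattice vector of norm less
  than 1, that is, not at all. So \<open>- x\<close> is in the monoid.\<close>

lemma real_point_add: "real_point (p + q) = real_point p + real_point q"
  by (simp add: real_point_def)

lemma real_point_zero [simp]: "real_point (0, 0) = 0"
  by (simp add: real_point_def zero_prod_def)

lemma inj_real_point: "inj real_point"
  by (auto simp: inj_def real_point_def prod_eq_iff)

lemma step_monoid_least:
  assumes "submonoid H int_plane" "X \<subseteq> H"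
  shows "carrier (step_monoid X) \<subseteq> H"
  using assms by (auto simp: step_monoid_def submonoid_generated_def)

lemma step_monoid_mult_one [simp]:
  "p \<otimes>\<^bsub>step_monoid X\<^esub> q = p + q" "\<one>\<^bsub>step_monoid X\<^esub> = (0, 0)"
  using int_plane_simps by (simp_all add: step_monoid_def submonoid_generated_def)

text \<open>Cancellation in the ambient group forces any inverse of \<open>p\<close> inside the
  submonoid to be \<open>- p\<close>.\<close>

lemma group_step_monoid_iff:
  "group (step_monoid X) \<longleftrightarrow>
    (\<forall>p \<in> carrier (step_monoid X). - p \<in> carrier (step_monoid X))"
proof
  assume "group (step_monoid X)"
  then interpret group "step_monoid X" .
  show "\<forall>p \<in> carrier (step_monoid X). - p \<in> carrier (step_monoid X)"
  proof
    fix p assume p: "p \<in> carrier (step_monoid X)"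
    have "p + inv\<^bsub>step_monoid X\<^esub> p = 0"
      using r_inv[OF p] by (simp add: zero_prod_def)
    then have "- p = inv\<^bsub>step_monoid X\<^esub> p"
      by (simp add: add_eq_0_iff)
    then show "- p \<in> carrier (step_monoid X)"
      using p by simp
  qed
next
  interpret S: submonoid "carrier (step_monoid X)" int_plane
    by (rule submonoid_step_monoid)
  assume neg: "\<forall>p \<in> carrier (step_monoid X). - p \<in> carrier (step_monoid X)"
  show "group (step_monoid X)"
  proof (rule groupI)
    fix p q assume "p \<in> carrier (step_monoid X)" "q \<in> carrier (step_monoid X)"
    then show "p \<otimes>\<^bsub>step_monoid X\<^esub> q \<in> carrier (step_monoid X)"
      using S.m_closed[of p q] by simp
  next
    fix p assume "p \<in> carrier (step_monoid X)"
    then show "\<exists>q \<in> carrier (step_monoid X). q \<otimes>\<^bsub>step_monoid X\<^esub> p = \<one>\<^bsub>step_monoid X\<^esub>"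
      using neg by (intro bexI[of _ "- p"]) (auto simp: zero_prod_def)
  qed (use S.one_closed in \<open>auto simp: add.assoc simp flip: zero_prod_def\<close>)
qed

text \<open>A convex cone is closed under addition. By minimality the whole step monoid then lies in
  any such cone that contains the steps.\<close>

lemma submonoid_vimage_cone:
  assumes "convex K" "cone K" "K \<noteq> {}"
  shows "submonoid (real_point -` K) int_plane"
proof
  show "\<one>\<^bsub>int_plane\<^esub> \<in> real_point -` K"
    using assms cone_contains_0 by auto
next
  fix p q assume "p \<in> real_point -` K" "q \<in> real_point -` K"
  moreover have "\<forall>x\<in>K. \<forall>y\<in>K. x + y \<in> K"
    using assms convex_cone by blast
  ultimately show "p \<otimes>\<^bsub>int_plane\<^esub> q \<in> real_point -` K"
    by (simp add: real_point_add)
qed auto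

text \<open>The combination is written by coordinates to match the relations supplied by
  \<open>integral_relation\<close>.\<close>

lemma submonoid_sum_closed:
  assumes "submonoid H int_plane" "finite T" "T \<subseteq> H"
  shows "((\<Sum>t\<in>T. int (n t) * fst t), (\<Sum>t\<in>T. int (n t) * snd t)) \<in> H"
proof -
  interpret submonoid H int_plane by fact
  have add: "p + q \<in> H" if "p \<in> H" "q \<in> H" for p q
    using m_closed[OF that] by simp
  have mult: "(int k * fst t, int k * snd t) \<in> H" if "t \<in> H" for k t
  proof (induction k)
    case 0
    then show ?case using one_closed by simp
  next
    case (Suc k)
    then show ?case using add[OF that Suc] by (cases t) (simp add: algebra_simps)
  qed
  from assms(2,3) show ?thesis
  proof (induction T)
    case empty
    then show ?case using one_closed by simp
  next
    case (insert t T)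
    then show ?case using add[OF mult[of t "n t"] insert.IH] by simp
  qed
qed

section \<open>Diophantine approximation and rounding of real relations\<close>

lemma Dirichlet_approx_finite:
  fixes c :: "'a \<Rightarrow> real"
  assumes "finite T" "\<delta> > 0"
  obtains q :: int and p :: "'a \<Rightarrow> int"
  where "q > 0" "\<And>t. t \<in> T \<Longrightarrow> \<bar>of_int q * c t - of_int (p t)\<bar> < \<delta>"
proof -
  obtain h where h: "bij_betw h {..<card T} T"
    using assms(1) ex_bij_betw_nat_finite atLeast0LessThan by metis
  obtain N :: nat where N: "N > 0" "1 / N < \<delta>"
    using assms(2) by (metis nat_approx_posE zero_less_Suc)
  obtain q p where q: "0 < q" 
    and p: "\<And>i. i < card T \<Longrightarrow> \<bar>of_int q * c (h i) - of_int (p i)\<bar> < 1 / N"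
    using Dirichlet_approx_simult[OF N(1), of "card T" "c \<circ> h"] by (metis comp_apply)
  show thesis
  proof
    fix t assume "t \<in> T"
    then obtain i where "i < card T" "t = h i" "the_inv_into {..<card T} h t = i"
      using h by (metis bij_betw_def imageE lessThan_iff the_inv_into_f_f)
    then show "\<bar>of_int q * c t - of_int ((p \<circ> the_inv_into {..<card T} h) t)\<bar> < \<delta>"
      using p[of i] N by simp
  qed (use q in auto)
qed

text \<open>As the real relation vanishes, the integer sum is minus the weighted sum of the rounding
  errors. Its absolute value is below 1, so it is 0. The summand 1 in the last hypothesis keeps the
  bound strict even if every \<open>f t\<close> is 0.\<close>

lemma round_relation_coordinate:
  fixes c :: "'a \<Rightarrow> real" and f p :: "'a \<Rightarrow> int"
  assumes "(\<Sum>t\<in>T. c t * f t) = 0" "finite T" "t0 \<in> T"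
    and "\<And>t. t \<in> T \<Longrightarrow> \<bar>of_int q * c t - of_int (p t)\<bar> < \<delta>"
    and "\<delta> * (1 + (\<Sum>t\<in>T. \<bar>real_of_int (f t)\<bar>)) \<le> 1"
  shows "(\<Sum>t\<in>T. p t * f t) = 0"
proof -
  have \<delta>: "\<delta> > 0" using assms(3,4) by fastforce
  have "real_of_int (\<Sum>t\<in>T. p t * f t) = (\<Sum>t\<in>T. p t * f t) - of_int q * (\<Sum>t\<in>T. c t * f t)"
    by (simp add: assms(1))
  also have "\<dots> = - (\<Sum>t\<in>T. (of_int q * c t - p t) * f t)"
    by (simp add: sum_distrib_left algebra_simps sum_subtractf)
  finally have "\<bar>real_of_int (\<Sum>t\<in>T. p t * f t)\<bar> = \<bar>\<Sum>t\<in>T. (of_int q * c t - p t) * f t\<bar>"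
    by simp
  also have "\<dots> \<le> (\<Sum>t\<in>T. \<bar>(of_int q * c t - p t) * f t\<bar>)"
    by (rule sum_abs)
  also have "\<dots> \<le> (\<Sum>t\<in>T. \<delta> * \<bar>real_of_int (f t)\<bar>)"
    unfolding abs_mult by (intro sum_mono mult_right_mono less_imp_le[OF assms(4)]) auto
  also have "\<dots> < \<delta> * (1 + (\<Sum>t\<in>T. \<bar>real_of_int (f t)\<bar>))"
    using \<delta> by (simp add: sum_distrib_left distrib_left)
  finally have "\<bar>real_of_int (\<Sum>t\<in>T. p t * f t)\<bar> < 1"
    using assms(5) by linarith
  then show ?thesis by linarith
qed

lemma integral_relation:
  fixes c :: "int \<times> int \<Rightarrow> real"
  assumes T: "finite T" "x \<in> T" and c: "\<And>t. t \<in> T \<Longrightarrow> c t \<ge> 0" "c x > 0"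
    and rel: "(\<Sum>t\<in>T. c t *\<^sub>R real_point t) = 0"
  obtains n :: "int \<times> int \<Rightarrow> nat"
  where "n x > 0" "(\<Sum>t\<in>T. int (n t) * fst t) = 0" "(\<Sum>t\<in>T. int (n t) * snd t) = 0"
proof -
  have rel1: "(\<Sum>t\<in>T. c t * fst t) = 0" "(\<Sum>t\<in>T. c t * snd t) = 0"
    using arg_cong[OF rel, of fst] arg_cong[OF rel, of snd]
    by (simp_all add: fst_sum snd_sum real_point_def)
  define F where "F = (\<Sum>t\<in>T. \<bar>real_of_int (fst t)\<bar>)"
  define G where "G = (\<Sum>t\<in>T. \<bar>real_of_int (snd t)\<bar>)"
  \<comment> \<open>The bound \<open>c x\<close> keeps the rounded coefficient at \<open>x\<close>
    positive; the other bound serves both coordinates at once and gives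
    \<open>\<delta> \<le> 1\<close>.\<close>
  define \<delta> where "\<delta> = min (c x) (1 / (1 + F + G))"
  have FG: "F \<ge> 0" "G \<ge> 0" by (auto simp: F_def G_def intro: sum_nonneg)
  have \<delta>: "\<delta> > 0" "\<delta> \<le> c x" "\<delta> \<le> 1 / (1 + F + G)" 
    using FG c(2) by (auto simp: \<delta>_def)
  have prod: "\<delta> * (1 + F + G) \<le> 1"
    using \<delta>(3) FG by (simp add: pos_le_divide_eq)
  have "\<delta> * 1 \<le> \<delta> * (1 + F + G)" "\<delta> * (1 + F) \<le> \<delta> * (1 + F + G)" "\<delta> * (1 + G) \<le> \<delta> * (1 + F + G)"
    using \<delta>(1) FG by (intro mult_left_mono; simp)+
  then have le: "\<delta> \<le> 1" "\<delta> * (1 + F) \<le> 1" "\<delta> * (1 + G) \<le> 1"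
    using prod by auto
  obtain q p where q: "q > 0" and p: "\<And>t. t \<in> T \<Longrightarrow> \<bar>of_int q * c t - of_int (p t)\<bar> < \<delta>"
    using Dirichlet_approx_finite[OF T(1) \<delta>(1)] by metis
  have nonneg: "p t \<ge> 0" if "t \<in> T" for t
  proof -
    have "of_int q * c t \<ge> 0" using q c(1)[OF that] by simp
    \<comment> \<open>The rounding error is below 1, and an integer above -1 is nonnegative.\<close>
    then have "real_of_int (p t) > -1" using p[OF that] le by linarith
    then show ?thesis by linarith
  qed
  \<comment> \<open>Since \<open>q \<ge> 1\<close>, the error at \<open>x\<close> is less than
    \<open>c x\<close> and hence less than \<open>q * c x\<close>.\<close>
  have "1 * c x \<le> of_int q * c x"
    using q c(2) by (intro mult_right_mono) auto
  then have "p x > 0" using p[OF T(2)] \<delta>(2) by auto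
  show thesis
  proof
    show "nat (p x) > 0" using \<open>p x > 0\<close> by simp
    have "(\<Sum>t\<in>T. p t * fst t) = 0" "(\<Sum>t\<in>T. p t * snd t) = 0"
      using round_relation_coordinate[OF rel1(1) T p] round_relation_coordinate[OF rel1(2) T p] le
      by (auto simp: F_def G_def)
    then show "(\<Sum>t\<in>T. int (nat (p t)) * fst t) = 0" "(\<Sum>t\<in>T. int (nat (p t)) * snd t) = 0"
      using nonneg by (simp_all cong: sum.cong)
  qed
qed

section \<open>From the convex hull back to the monoid\<close>

text \<open>Moving \<open>- e *\<^sub>R real_point x\<close> to the other side of its convex
  combination gives a vanishing relation with positive weight at \<open>x\<close>. In the integral
  version, dropping one copy of \<open>x\<close> leaves a sum of steps equal to
  \<open>- x\<close>.\<close>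

lemma uminus_mem_step_monoid:
  assumes x: "x \<in> X" and e: "e > 0" "- e *\<^sub>R real_point x \<in> Conv X"
  shows "- x \<in> carrier (step_monoid X)"
proof -
  obtain S u where S: "finite S" "S \<subseteq> real_point ` X" "\<forall>v\<in>S. 0 \<le> u v"
    and u: "(\<Sum>v\<in>S. u v *\<^sub>R v) = - e *\<^sub>R real_point x"
    using e(2) unfolding Conv_def convex_hull_explicit by blast
  obtain T where T: "finite T" "T \<subseteq> X" "S = real_point ` T"
    using finite_subset_image[OF S(1,2)] by metis
  \<comment> \<open>The point \<open>x\<close> may or may not occur in \<open>T\<close>, so
    \<open>e\<close> is added to its hull weight, which defaults to 0, and the sums run over
    \<open>insert x T\<close>.\<close>
  define c where "c t = (if t \<in> T then u (real_point t) else 0) + (if t = x then e else 0)" for t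
  have "(\<Sum>t\<in>insert x T. c t *\<^sub>R real_point t)
      = (\<Sum>t\<in>insert x T. (if t \<in> T then u (real_point t) *\<^sub>R real_point t else 0))
      + (\<Sum>t\<in>insert x T. (if t = x then e *\<^sub>R real_point t else 0))"
    unfolding sum.distrib[symmetric] by (intro sum.cong) (auto simp: c_def scaleR_add_left)
  also have "(\<Sum>t\<in>insert x T. (if t \<in> T then u (real_point t) *\<^sub>R real_point t else 0))
      = (\<Sum>t\<in>T. u (real_point t) *\<^sub>R real_point t)"
    using T(1) by (intro sum.mono_neutral_cong_right) auto
  also have "\<dots> = (\<Sum>v\<in>S. u v *\<^sub>R v)"
    unfolding T(3) using inj_real_point by (subst sum.reindex) (auto intro: inj_on_subset)
  also have "(\<Sum>t\<in>insert x T. (if t = x then e *\<^sub>R real_point t else 0)) = e *\<^sub>R real_point x"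
    using T(1) by simp
  finally have "(\<Sum>t\<in>insert x T. c t *\<^sub>R real_point t) = 0"
    by (simp add: u)
  moreover have "c t \<ge> 0" for t
    using S(3) T(3) e(1) by (auto simp: c_def)
  moreover have "c x > 0"
    using S(3) T(3) e(1) by (auto simp: c_def add_nonneg_pos)
  ultimately obtain n where n: "n x > 0"
    "(\<Sum>t\<in>insert x T. int (n t) * fst t) = 0" "(\<Sum>t\<in>insert x T. int (n t) * snd t) = 0"
    using integral_relation[of "insert x T" x c] T(1) by auto
  \<comment> \<open>As \<open>n x > 0\<close>, the subtraction on naturals does not
    truncate.\<close>
  define m where "m = n(x := n x - 1)"
  have m: "int (m t) = int (n t) - (if t = x then 1 else 0)" for t
    using n(1) by (auto simp: m_def)
  have if_mult: "(if P then 1 else 0) * a = (if P then a else 0)" for P and a :: int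
    by simp
  have "(\<Sum>t\<in>insert x T. int (m t) * fst t) = - fst x" "(\<Sum>t\<in>insert x T. int (m t) * snd t) = - snd x"
    unfolding m left_diff_distrib sum_subtractf n if_mult using T(1) by simp_all
  moreover have "insert x T \<subseteq> carrier (step_monoid X)"
    using subset_step_monoid x T(2) by auto
  ultimately show ?thesis
    using submonoid_sum_closed[OF submonoid_step_monoid, of "insert x T" X m] T(1)
    by (simp add: uminus_prod_def)
qed

theorem theorem2p34:
  fixes X :: "(int \<times> int) set"
  assumes "step_set X" and "X \<noteq> {}"
  shows "group (step_monoid X) \<longleftrightarrow> (0, 0) \<in> rel_interior (Conv X)"
proof -
  have C: "convex (Conv X)" "Conv X \<noteq> {}" "real_point ` X \<subseteq> Conv X"
    using assms(2) by (auto simp: Conv_def hull_subset)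
  \<comment> \<open>Geometrically, the segment from \<open>y\<close> to the origin can be prolonged
    beyond the origin within the hull.\<close>
  have rel_int: "(0, 0) \<in> rel_interior (Conv X) \<longleftrightarrow> (\<forall>y\<in>Conv X. \<exists>e>1. (1 - e) *\<^sub>R y \<in> Conv X)"
    using convex_rel_interior_iff[OF C(1,2), of "(0, 0)"] by (simp flip: zero_prod_def)
  show ?thesis
  proof
    assume "group (step_monoid X)"
    then have neg: "- p \<in> carrier (step_monoid X)" if "p \<in> carrier (step_monoid X)" for p
      using that by (simp add: group_step_monoid_iff)
    define K where "K = cone hull Conv X"
    have K: "convex K" "cone K" "K \<noteq> {}" "Conv X \<subseteq> K"
      using C by (simp_all add: K_def cone_hull_empty_iff[symmetric] convex_cone_hull cone_cone_hull hull_subset)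
    have "carrier (step_monoid X) \<subseteq> real_point -` K"
      using step_monoid_least[OF submonoid_vimage_cone[OF K(1-3)]] C(3) K(4) by blast
    then have "- real_point x \<in> K" if "x \<in> X" for x
      using neg[of x] that subset_step_monoid[of X] by (force simp: real_point_def)
    then have "real_point ` X \<subseteq> uminus ` K"
      by (force simp: image_iff)
    \<comment> \<open>The negated cone is convex, so containing the steps it contains their
      hull.\<close>
    then have "Conv X \<subseteq> uminus ` K"
      unfolding Conv_def using convex_negations[OF K(1)] by (intro hull_minimal)
    have "\<exists>e>1. (1 - e) *\<^sub>R y \<in> Conv X" if y: "y \<in> Conv X" for y
    proof -
      have "- y \<in> K"
        using y \<open>Conv X \<subseteq> uminus ` K\<close> by auto
      then obtain a z where a: "- y = a *\<^sub>R z" "a \<ge> 0" "z \<in> Conv X"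
        unfolding K_def cone_hull_expl by blast
      show ?thesis
      proof (cases "a = 0")
        case True
        \<comment> \<open>Here \<open>y\<close> is the origin, so any \<open>e > 1\<close> would
          do.\<close>
        then show ?thesis using a y by (intro exI[of _ 2]) simp
      next
        case False
        have "y = - (a *\<^sub>R z)"
          using a(1) by (metis minus_minus)
        \<comment> \<open>Solving \<open>- y = a *\<^sub>R z\<close> for \<open>z\<close> dictates
          \<open>e = 1 + 1 / a\<close>.\<close>
        then have "(1 - (1 + 1 / a)) *\<^sub>R y = z"
          using False by simp
        then show ?thesis
          using a False by (intro exI[of _ "1 + 1 / a"]) simp
      qed
    qed
    then show "(0, 0) \<in> rel_interior (Conv X)"
      by (simp add: rel_int)
  next
    assume "(0, 0) \<in> rel_interior (Conv X)"
    have negX: "- x \<in> carrier (step_monoid X)" if x: "x \<in> X" for x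
    proof -
      obtain e where "e > 1" "(1 - e) *\<^sub>R real_point x \<in> Conv X"
        using \<open>(0, 0) \<in> rel_interior (Conv X)\<close> C(3) x rel_int by blast
      then show ?thesis
        using uminus_mem_step_monoid[OF x, of "e - 1"] by simp
    qed
    interpret S: submonoid "carrier (step_monoid X)" int_plane
      by (rule submonoid_step_monoid)
    \<comment> \<open>Negatives of steps being in the monoid, its negation is a submonoid containing
      \<open>X\<close>; minimality extends closure under negation from the steps to all
      elements.\<close>
    have "submonoid (uminus ` carrier (step_monoid X)) int_plane"
    proof
      show "\<one>\<^bsub>int_plane\<^esub> \<in> uminus ` carrier (step_monoid X)"
        using S.one_closed by (force simp: image_iff)
    next
      fix p q assume "p \<in> uminus ` carrier (step_monoid X)" "q \<in> uminus ` carrier (step_monoid X)"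
      then obtain p' q' where "p = - p'" "q = - q'"
        "p' \<in> carrier (step_monoid X)" "q' \<in> carrier (step_monoid X)" by blast
      then show "p \<otimes>\<^bsub>int_plane\<^esub> q \<in> uminus ` carrier (step_monoid X)"
        using S.m_closed[of p' q'] by (intro image_eqI[of _ _ "p' + q'"]) auto
    qed auto
    moreover have "X \<subseteq> uminus ` carrier (step_monoid X)"
      using negX by (force simp: image_iff)
    ultimately have "carrier (step_monoid X) \<subseteq> uminus ` carrier (step_monoid X)"
      by (rule step_monoid_least)
    then show "group (step_monoid X)"
      by (force simp: group_step_monoid_iff)
  qed
qed

end
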